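(* Let $U$ be an open subset of $\mathbb{R}^d$ and let $\mathbf{L}_1,\ldots,\mathbf{L}_r$ and $\mathbf{L}$ be $m\times n$ matrices of linear partial differential operators with coefficients from $\mathcal{C}(U)$. Then the following are equivalent: (1) For every $\boldsymbol{\phi}\in\mathcal{C}^{(\infty)}_c(U)^n$ and every $\boldsymbol{\psi}\in\mathcal{C}^{(\infty)}_c(U)^m$ such that $\langle\mathbf{L}_1\boldsymbol{\phi},\boldsymbol{\psi}\rangle=\cdots=\langle\mathbf{L}_r\boldsymbol{\phi},\boldsymbol{\psi}\rangle=0$ we have $\langle\mathbf{L}\boldsymbol{\phi},\boldsymbol{\psi}\rangle=0$. (2) For every $\boldsymbol{\phi}\in\mathcal{C}^{(\infty)}_c(U)^n$ we have $\mathbf{L}\boldsymbol{\phi}\in\mathrm{Lin}\{\mathbf{L}_1\boldsymbol{\phi},\ldots,\mathbf{L}_r\boldsymbol{\phi}\}$. (3) $\mathbf{L}\in\mathrm{Lin}\{\mathbf{L}_1,\ldots,\mathbf{L}_r\}$.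
   Context: $\mathcal{C}(U)$ is the real vector space of all continuous real functions on $U$, $\mathcal{C}_c(U)$ its subspace of functions with compact support, and $\mathcal{C}^{(\infty)}_c(U)$ the real vector space of all infinitely differentiable real functions with compact support on $U$. The space $\mathcal{C}_c(U)^m$ has the standard inner product $\langle\mathbf{f},\mathbf{g}\rangle=\sum_{i=1}^m\int_U f_ig_i$. An $m\times n$ matrix of linear partial differential operators with coefficients from $\mathcal{C}(U)$ can be written as a finite sum $\sum_{\alpha\in\mathbb{N}_0^d,\,|\alpha|\le s}\mathbf{P}_\alpha D^\alpha$ for some $s\in\mathbb{N}_0$, where $\mathbf{P}_\alpha\in\mathcal{C}(U)^{m\times n}$ and $D^\alpha=\frac{\partial^{|\alpha|}}{(\partial x_1)^{\alpha_1}\cdots(\partial x_d)^{\alpha_d}}$; it acts on column vectors $\boldsymbol{\phi}=[\phi_1,\ldots,\phi_n]^T$ with $D^\alpha$ applied entrywise. $\mathrm{Lin}$ denotes the linear span over $\mathbb{R}$ (with constant real coefficients); matrices of operators are equal when their coefficient matrices are equal on $U$. *)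

theory Defs
  imports "HOL-Analysis.Analysis"
begin

text \<open>
  Functions on an open set \<open>U\<close> are represented by total functions whose values outside \<open>U\<close> are
  irrelevant: no notion below depends on them, and equality is always stated pointwise on \<open>U\<close>.

  The index type \<open>'d\<close> of the coordinates is linearly ordered (like \<open>1 < \<dots> < d\<close>) only so
  that \<open>D\<^sup>\<alpha>\<close> has a definite order of differentiation; for smooth functions the order
  does not matter.  Index types are nonempty, so \<open>d \<ge> 1\<close>.
\<close>

definition partial_deriv :: "'d::finite \<Rightarrow> (real^'d \<Rightarrow> real) \<Rightarrow> real^'d \<Rightarrow> real" where
  "partial_deriv i f x = deriv (\<lambda>t. f (x + t *\<^sub>R axis i 1)) 0"

definition smooth_on :: "(real^'d::finite) set \<Rightarrow> (real^'d \<Rightarrow> real) \<Rightarrow> bool" where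
  "smooth_on U f \<longleftrightarrow> (\<forall>is. (foldr partial_deriv is f) differentiable_on U)"

text \<open>
  Since \<open>U\<close> carries the subspace topology, the support of a function on \<open>U\<close> is the closure
  relative to \<open>U\<close> of the set where the function is nonzero.
\<close>

definition Cc_smooth :: "(real^'d::finite) set \<Rightarrow> (real^'d \<Rightarrow> real) set" where
  "Cc_smooth U = {f. smooth_on U f \<and> compact (U \<inter> closure (support_on U f))}"

definition Cc_smooth_vec :: "(real^'d::finite) set \<Rightarrow> (real^'d \<Rightarrow> real^'n::finite) set" where
  "Cc_smooth_vec U = {\<phi>. \<forall>j. (\<lambda>x. \<phi> x $ j) \<in> Cc_smooth U}"

definition inner_on ::
  "(real^'d::finite) set \<Rightarrow> (real^'d \<Rightarrow> real^'m::finite) \<Rightarrow> (real^'d \<Rightarrow> real^'m) \<Rightarrow> real" where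
  "inner_on U f g = (\<Sum>i\<in>UNIV. LINT x:U|lborel. f x $ i * g x $ i)"

definition multi_order :: "nat^'d::finite \<Rightarrow> nat" where
  "multi_order \<alpha> = (\<Sum>i\<in>UNIV. \<alpha> $ i)"

definition multi_deriv ::
  "nat^'d::{finite,linorder} \<Rightarrow> (real^'d::{finite,linorder} \<Rightarrow> real) \<Rightarrow> real^'d::{finite,linorder} \<Rightarrow> real" where
  "multi_deriv \<alpha> f = foldr (\<lambda>i. partial_deriv i ^^ (\<alpha> $ i)) (sorted_list_of_set UNIV) f"

text \<open>
  A matrix of operators \<open>\<Sum>\<^sub>\<alpha> P\<^sub>\<alpha> D\<^sup>\<alpha>\<close> with \<open>m\<close> rows and \<open>n\<close> columns is
  its family of coefficient matrices \<open>P\<close>.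
\<close>

type_synonym ('d, 'n, 'm) pdo = "nat^'d \<Rightarrow> real^'d \<Rightarrow> real^'n^'m"

definition is_pdo :: "(real^'d::finite) set \<Rightarrow> ('d, 'n::finite, 'm::finite) pdo \<Rightarrow> bool" where
  "is_pdo U P \<longleftrightarrow>
     (\<forall>\<alpha>. continuous_on U (P \<alpha>)) \<and>
     (\<exists>s. \<forall>\<alpha>. multi_order \<alpha> > s \<longrightarrow> (\<forall>x\<in>U. P \<alpha> x = 0))"

text \<open>The index set of the following sum is finite whenever \<open>is_pdo U P\<close>.\<close>

definition pdo_apply ::
  "(real^'d::{finite,linorder}) set \<Rightarrow> ('d, 'n::finite, 'm::finite) pdo
     \<Rightarrow> (real^'d::{finite,linorder} \<Rightarrow> real^'n) \<Rightarrow> real^'d::{finite,linorder} \<Rightarrow> real^'m" where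
  "pdo_apply U P \<phi> x =
     (\<Sum>\<alpha> | \<exists>y\<in>U. P \<alpha> y \<noteq> 0. P \<alpha> x *v (\<chi> j. multi_deriv \<alpha> (\<lambda>y. \<phi> y $ j) x))"

definition fun_in_Lin ::
  "(real^'d::finite) set \<Rightarrow> nat \<Rightarrow> (nat \<Rightarrow> real^'d \<Rightarrow> real^'m::finite)
     \<Rightarrow> (real^'d \<Rightarrow> real^'m) \<Rightarrow> bool" where
  "fun_in_Lin U r fs f \<longleftrightarrow>
     (\<exists>c::nat \<Rightarrow> real. \<forall>x\<in>U. f x = (\<Sum>k=1..r. c k *\<^sub>R fs k x))"

definition pdo_in_Lin ::
  "(real^'d::finite) set \<Rightarrow> nat \<Rightarrow> (nat \<Rightarrow> ('d, 'n::finite, 'm::finite) pdo)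
     \<Rightarrow> ('d, 'n, 'm) pdo \<Rightarrow> bool" where
  "pdo_in_Lin U r Ps P \<longleftrightarrow>
     (\<exists>c::nat \<Rightarrow> real. \<forall>\<alpha>. \<forall>x\<in>U. P \<alpha> x = (\<Sum>k=1..r. c k *\<^sub>R Ps k \<alpha> x))"

end

theory Submission
  imports Defs
begin

text \<open>
  If \<open>L = \<Sum> c\<^sub>k L\<^sub>k\<close>, then \<open>L \<phi> = \<Sum> c\<^sub>k L\<^sub>k \<phi>\<close> for every \<open>\<phi>\<close>, and then \<open>L \<phi>\<close> is
  orthogonal to every \<open>\<psi>\<close> to which all \<open>L\<^sub>k \<phi>\<close> are orthogonal. The content lies in the two converses.
  
  For a fixed \<open>\<phi>\<close>, the orthogonality condition says that the functional \<open>\<langle>L \<phi>, \<cdot>\<rangle>\<close> on test functions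
  vanishes on the common kernel of the functionals \<open>\<langle>L\<^sub>k \<phi>, \<cdot>\<rangle>\<close>. A functional with this property is
  a linear combination of those (\<open>functional_in_span\<close>), and the fundamental lemma of the calculus of
  variations (\<open>zero_if_orthogonal_to_Cc_smooth_vec\<close>) turns the relation between functionals into one
  between functions, \<open>L \<phi> = \<Sum> c\<^sub>k L\<^sub>k \<phi>\<close> on \<open>U\<close>, with coefficients that may depend on \<open>\<phi>\<close>.
  
  The coefficients can be chosen independently of \<open>\<phi>\<close> because differential operators are local. A
  single \<open>\<phi>\<close> can have an independently prescribed unit vector as its jet at each of finitely many
  distinct points (\<open>Cc_smooth_vec_with_jets\<close>), and there \<open>L \<phi>\<close> and the \<open>L\<^sub>k \<phi>\<close> exhibit individual
  coefficients of the operators (\<open>pdo_apply_jet\<close>). Hence at finitely many distinct points, with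
  one coefficient position selected at each of them, common constants express the coefficients of
  \<open>L\<close> by those of the \<open>L\<^sub>k\<close>. In the finite-dimensional space of constants, at most \<open>r\<close> of these
  linear conditions fix everything that all of them together can fix. Different conditions must
  sit at different points, but the coefficients are continuous on a set without isolated points, so
  a point that is already taken can be approached by others. The relation therefore extends to all
  points and all positions at once (\<open>combination_from_finitely_many_points\<close>).
  
  The test functions are sums of tensor products of functions of one variable, built from the
  function \<open>exp (- 1 / t)\<close>. Their partial derivatives are obtained by differentiating the factors.
\<close>

section \<open>From finitely many points to a common combination\<close>

lemma zero_at_puncture:
  fixes h :: "'a::{perfect_space,t2_space} \<Rightarrow> real"
  assumes "open U" "continuous_on U h" "x0 \<in> U" and zero: "\<And>x. x \<in> U - {x0} \<Longrightarrow> h x = 0"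
  shows "h x0 = 0"
proof -
  have "(h \<longlongrightarrow> h x0) (at x0)"
    using assms(2,3) unfolding continuous_on_eq_continuous_at[OF assms(1)] isCont_def by blast
  moreover have "eventually (\<lambda>x. h x = 0) (at x0)"
    unfolding eventually_at_topological using assms(1,3) zero by (intro exI[of _ U]) auto
  then have "(h \<longlongrightarrow> 0) (at x0)"
    by (simp add: tendsto_eventually)
  ultimately show ?thesis
    by (rule tendsto_unique[OF trivial_limit_at])
qed

text \<open>
  Gaussian elimination in the coefficients. A coefficient tuple may depend on the finite set and on
  the test \<open>\<tau> x\<close> chosen at each of its points. If \<open>A l\<close> does not vanish at some \<open>(x0, t0)\<close>,
  adding \<open>x0\<close> with the test \<open>t0\<close> to every finite set determines the coefficient of \<open>A l\<close> from
  the others, and one function fewer remains. A finite set carries only one test per point, so \<open>x0\<close>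
  is used up and the induction continues on \<open>U - {x0}\<close>. Continuity in \<open>x\<close> and the absence of
  isolated points bring \<open>x0\<close> back at the end.
\<close>

lemma combination_from_finitely_many_points:
  fixes A :: "'k \<Rightarrow> 'a::{perfect_space,t2_space} \<Rightarrow> 't \<Rightarrow> real"
  assumes "finite K" and "open U"
    and "\<And>k t. k \<in> K \<Longrightarrow> continuous_on U (\<lambda>x. A k x t)"
    and "\<And>t. continuous_on U (\<lambda>x. B x t)"
    and "\<And>F \<tau>. finite F \<Longrightarrow> F \<subseteq> U \<Longrightarrow>
           \<exists>c. \<forall>x\<in>F. B x (\<tau> x) = (\<Sum>k\<in>K. c k * A k x (\<tau> x))"
  shows "\<exists>c. \<forall>x\<in>U. \<forall>t. B x t = (\<Sum>k\<in>K. c k * A k x t)"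
  using assms
proof (induction K arbitrary: U A B rule: finite_induct)
  case empty
  have "B x t = 0" if "x \<in> U" for x t
    using empty.prems(4)[of "{x}" "\<lambda>_. t"] that by simp
  then show ?case by simp
next
  case (insert l K)
  show ?case
  proof (cases "\<forall>x\<in>U. \<forall>t. A l x t = 0")
    case True
    have fin: "\<exists>c. \<forall>x\<in>F. B x (\<tau> x) = (\<Sum>k\<in>K. c k * A k x (\<tau> x))"
      if F: "finite F" "F \<subseteq> U" for F \<tau>
    proof -
      obtain c where c: "\<And>x. x \<in> F \<Longrightarrow> B x (\<tau> x) = (\<Sum>k\<in>insert l K. c k * A k x (\<tau> x))"
        using insert.prems(4)[OF F] by blast
      have "\<forall>x\<in>F. B x (\<tau> x) = (\<Sum>k\<in>K. c k * A k x (\<tau> x))"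
        using c insert.hyps True F by (auto simp: subset_iff)
      then show ?thesis by blast
    qed
    have "\<exists>c. \<forall>x\<in>U. \<forall>t. B x t = (\<Sum>k\<in>K. c k * A k x t)"
      using insert.prems(1) insert.prems(2)[OF insertI2] insert.prems(3) fin by (rule insert.IH)
    then obtain c where c: "\<And>x t. x \<in> U \<Longrightarrow> B x t = (\<Sum>k\<in>K. c k * A k x t)" by blast
    have "\<forall>x\<in>U. \<forall>t. B x t = (\<Sum>k\<in>insert l K. c k * A k x t)"
      using c insert.hyps True by auto
    then show ?thesis by blast
  next
    case False
    then obtain x0 t0 where x0: "x0 \<in> U" and nz: "A l x0 t0 \<noteq> 0" by blast
    \<comment> \<open>The equation at \<open>(x0, t0)\<close> determines the coefficient of \<open>A l\<close>; substituting it into the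
       other equations leaves \<open>A'\<close> and \<open>B'\<close>.\<close>
    define A' where "A' k x t = A k x t - A k x0 t0 / A l x0 t0 * A l x t" for k x t
    define B' where "B' x t = B x t - B x0 t0 / A l x0 t0 * A l x t" for x t
    have cA: "continuous_on U (\<lambda>x. A' k x t)" if "k \<in> K" for k t
      unfolding A'_def using that insert.prems(2) by (intro continuous_intros) auto
    have cB: "continuous_on U (\<lambda>x. B' x t)" for t
      unfolding B'_def using insert.prems(2,3) by (intro continuous_intros) auto
    have sum_A': "(\<Sum>k\<in>K. c k * A' k x t) =
        (\<Sum>k\<in>K. c k * A k x t) - (\<Sum>k\<in>K. c k * A k x0 t0) / A l x0 t0 * A l x t" for c x t
    proof -
      have "(\<Sum>k\<in>K. c k * A' k x t) =
          (\<Sum>k\<in>K. c k * A k x t - c k * A k x0 t0 * (A l x t / A l x0 t0))"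
        unfolding A'_def by (intro sum.cong refl) (simp add: right_diff_distrib)
      then show ?thesis
        by (simp only: sum_subtractf sum_distrib_right[symmetric]) simp
    qed
    have fin: "\<exists>c. \<forall>x\<in>F. B' x (\<tau> x) = (\<Sum>k\<in>K. c k * A' k x (\<tau> x))"
      if F: "finite F" "F \<subseteq> U - {x0}" for F \<tau>
    proof -
      obtain c where "\<forall>x\<in>insert x0 F. B x ((\<tau>(x0 := t0)) x) =
          (\<Sum>k\<in>insert l K. c k * A k x ((\<tau>(x0 := t0)) x))"
        using insert.prems(4)[of "insert x0 F" "\<tau>(x0 := t0)"] F x0 by blast
      then have c: "B x ((\<tau>(x0 := t0)) x) =
          c l * A l x ((\<tau>(x0 := t0)) x) + (\<Sum>k\<in>K. c k * A k x ((\<tau>(x0 := t0)) x))"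
        if "x \<in> insert x0 F" for x
        using that by (auto simp del: fun_upd_apply simp: sum.insert[OF insert.hyps(1,2)])
      have c0: "B x0 t0 = c l * A l x0 t0 + (\<Sum>k\<in>K. c k * A k x0 t0)"
        using c[of x0] by simp
      have "B' x (\<tau> x) = (\<Sum>k\<in>K. c k * A' k x (\<tau> x))" if "x \<in> F" for x
      proof -
        have "x \<noteq> x0" using F that by blast
        then have "B x (\<tau> x) = c l * A l x (\<tau> x) + (\<Sum>k\<in>K. c k * A k x (\<tau> x))"
          using c[of x] that by simp
        then show ?thesis
          unfolding B'_def sum_A' c0 using nz by (simp add: add_divide_distrib distrib_right)
      qed
      then show ?thesis by blast
    qed
    have "\<exists>c. \<forall>x\<in>U - {x0}. \<forall>t. B' x t = (\<Sum>k\<in>K. c k * A' k x t)"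
      using open_delete[OF insert.prems(1)] continuous_on_subset[OF cA Diff_subset]
        continuous_on_subset[OF cB Diff_subset] fin
      by (rule insert.IH)
    then obtain c where c: "\<And>x t. x \<in> U - {x0} \<Longrightarrow> B' x t = (\<Sum>k\<in>K. c k * A' k x t)"
      by blast
    have c': "B' x t = (\<Sum>k\<in>K. c k * A' k x t)" if "x \<in> U" for x t
    proof (cases "x = x0")
      case True
      have "B' x0 t - (\<Sum>k\<in>K. c k * A' k x0 t) = 0"
      proof (rule zero_at_puncture[OF insert.prems(1) _ x0])
        show "continuous_on U (\<lambda>x. B' x t - (\<Sum>k\<in>K. c k * A' k x t))"
          using cA cB by (intro continuous_intros) auto
      qed (use c in auto)
      with True show ?thesis by simp
    qed (use c that in auto)
    define e where "e = c(l := (B x0 t0 - (\<Sum>k\<in>K. c k * A k x0 t0)) / A l x0 t0)"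
    have "B x t = (\<Sum>k\<in>insert l K. e k * A k x t)" if "x \<in> U" for x t
    proof -
      have "(\<Sum>k\<in>K. e k * A k x t) = (\<Sum>k\<in>K. c k * A k x t)"
        unfolding e_def using insert.hyps by (intro sum.cong) auto
      then show ?thesis
        using c'[OF that, of t] insert.hyps unfolding B'_def sum_A'
        by (simp add: e_def diff_divide_distrib left_diff_distrib)
    qed
    then show ?thesis by blast
  qed
qed

section \<open>Functionals vanishing on a common kernel\<close>

text \<open>
  The kernel criterion for linear dependence of finitely many functionals, by induction on their number.
  Either \<open>\<Lambda> l\<close> is already determined by the kernel of the others and can be dropped, or some
  \<open>f0\<close> isolates it, and then \<open>M\<close> minus the right multiple of \<open>\<Lambda> l\<close> vanishes on the common
  kernel of the others.
\<close>

lemma functional_in_span: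
  fixes V :: "('x \<Rightarrow> 'v::real_vector) set" and \<Lambda> :: "'k \<Rightarrow> ('x \<Rightarrow> 'v) \<Rightarrow> real"
  assumes "finite K"
    and closed: "\<And>f g a. f \<in> V \<Longrightarrow> g \<in> V \<Longrightarrow> (\<lambda>x. f x + a *\<^sub>R g x) \<in> V"
    and "\<And>k f g a. k \<in> K \<Longrightarrow> f \<in> V \<Longrightarrow> g \<in> V \<Longrightarrow> \<Lambda> k (\<lambda>x. f x + a *\<^sub>R g x) = \<Lambda> k f + a * \<Lambda> k g"
    and "\<And>f g a. f \<in> V \<Longrightarrow> g \<in> V \<Longrightarrow> M (\<lambda>x. f x + a *\<^sub>R g x) = M f + a * M g"
    and "\<And>f. f \<in> V \<Longrightarrow> (\<forall>k\<in>K. \<Lambda> k f = 0) \<Longrightarrow> M f = 0"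
  shows "\<exists>c. \<forall>f\<in>V. M f = (\<Sum>k\<in>K. c k * \<Lambda> k f)"
  using assms(1,3-)
proof (induction K arbitrary: M rule: finite_induct)
  case empty
  then show ?case by simp
next
  case (insert l K)
  show ?case
  proof (cases "\<exists>f0\<in>V. (\<forall>k\<in>K. \<Lambda> k f0 = 0) \<and> \<Lambda> l f0 \<noteq> 0")
    case True
    then obtain f0 where f0: "f0 \<in> V" "\<And>k. k \<in> K \<Longrightarrow> \<Lambda> k f0 = 0" "\<Lambda> l f0 \<noteq> 0" by blast
    define b where "b = M f0 / \<Lambda> l f0"
    have "\<exists>c. \<forall>f\<in>V. M f - b * \<Lambda> l f = (\<Sum>k\<in>K. c k * \<Lambda> k f)"
    proof (rule insert.IH)
      fix f assume f: "f \<in> V" "\<forall>k\<in>K. \<Lambda> k f = 0"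
      \<comment> \<open>Subtracting a multiple of \<open>f0\<close> moves \<open>f\<close> into the kernel of \<open>\<Lambda> l\<close> too.\<close>
      define g where "g = (\<lambda>x. f x + (- \<Lambda> l f / \<Lambda> l f0) *\<^sub>R f0 x)"
      have "M g = 0"
      proof (rule insert.prems(3))
        show "g \<in> V" unfolding g_def using f f0 closed by blast
        have "\<Lambda> k g = \<Lambda> k f + (- \<Lambda> l f / \<Lambda> l f0) * \<Lambda> k f0" if "k \<in> insert l K" for k
          unfolding g_def using that f(1) f0(1) by (rule insert.prems(1))
        with f f0 show "\<forall>k\<in>insert l K. \<Lambda> k g = 0" by simp
      qed
      moreover have "M g = M f + (- \<Lambda> l f / \<Lambda> l f0) * M f0"
        unfolding g_def using f(1) f0(1) by (rule insert.prems(2))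
      ultimately show "M f - b * \<Lambda> l f = 0"
        using f0(3) by (simp add: b_def field_simps)
    qed (use insert.prems in \<open>auto simp: algebra_simps\<close>)
    then obtain c where c: "\<And>f. f \<in> V \<Longrightarrow> M f - b * \<Lambda> l f = (\<Sum>k\<in>K. c k * \<Lambda> k f)" by blast
    have "\<forall>f\<in>V. M f = (\<Sum>k\<in>insert l K. (c(l := b)) k * \<Lambda> k f)"
    proof
      fix f assume f: "f \<in> V"
      have "(\<Sum>k\<in>K. (c(l := b)) k * \<Lambda> k f) = (\<Sum>k\<in>K. c k * \<Lambda> k f)"
        using insert.hyps by (intro sum.cong) auto
      then show "M f = (\<Sum>k\<in>insert l K. (c(l := b)) k * \<Lambda> k f)"
        using c[OF f] insert.hyps by simp
    qed
    then show ?thesis by blast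
  next
    case False
    have "\<exists>c. \<forall>f\<in>V. M f = (\<Sum>k\<in>K. c k * \<Lambda> k f)"
      using False insert.prems by (intro insert.IH) auto
    then obtain c where c: "\<And>f. f \<in> V \<Longrightarrow> M f = (\<Sum>k\<in>K. c k * \<Lambda> k f)" by blast
    have "(\<Sum>k\<in>K. (c(l := 0)) k * \<Lambda> k f) = (\<Sum>k\<in>K. c k * \<Lambda> k f)" for f
      using insert.hyps by (intro sum.cong) auto
    then have "\<forall>f\<in>V. M f = (\<Sum>k\<in>insert l K. (c(l := 0)) k * \<Lambda> k f)"
      using c insert.hyps by simp
    then show ?thesis by blast
  qed
qed

section \<open>Smooth functions of one real variable\<close>

text \<open>
  For \<open>q = 1\<close> this is the standard smooth function that is flat at \<open>0\<close>. The polynomial factor in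
  \<open>1 / t\<close> makes the family closed under differentiation.
\<close>

definition exp_flat :: "real poly \<Rightarrow> real \<Rightarrow> real" where
  "exp_flat q t = (if t > 0 then poly q (1 / t) * exp (- 1 / t) else 0)"

lemma poly_over_exp_tendsto_0: "((\<lambda>u::real. poly q u * exp (- u)) \<longlongrightarrow> 0) at_top"
proof -
  have "((\<lambda>u. \<Sum>i\<le>degree q. coeff q i * (u ^ i / exp u)) \<longlongrightarrow> (\<Sum>i\<le>degree q. coeff q i * 0)) at_top"
    by (intro tendsto_intros tendsto_power_div_exp_0)
  then show ?thesis
    by (simp add: poly_altdef exp_minus divide_inverse sum_distrib_right mult.assoc)
qed

lemma exp_flat_tendsto_0: "(exp_flat q \<longlongrightarrow> 0) (at 0)"
proof -
  \<comment> \<open>The substitution \<open>u = 1 / t\<close>.\<close>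
  have "((\<lambda>t::real. poly q (inverse t) * exp (- inverse t)) \<longlongrightarrow> 0) (at_right 0)"
    using poly_over_exp_tendsto_0 filterlim_inverse_at_top_right
    by (rule filterlim_compose)
  then have "(exp_flat q \<longlongrightarrow> 0) (at_right 0)"
    by (rule Lim_transform_eventually)
      (auto simp: eventually_at_filter exp_flat_def inverse_eq_divide intro!: always_eventually)
  moreover have "(exp_flat q \<longlongrightarrow> 0) (at_left 0)"
    by (rule tendsto_eventually) (auto simp: eventually_at_filter exp_flat_def)
  ultimately show ?thesis
    by (simp add: filterlim_split_at)
qed

lemma exp_flat_deriv:
  "(exp_flat q has_real_derivative exp_flat ([:0, 0, 1:] * (q - pderiv q)) t) (at t)"
proof -
  consider "t < 0" | "t = 0" | "t > 0" by linarith
  then show ?thesis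
  proof cases
    case 1
    have "((\<lambda>_. 0) has_real_derivative 0) (at t)" by simp
    then have "(exp_flat q has_real_derivative 0) (at t)"
      by (rule has_field_derivative_transform_within_open[where S = "{..<0}"])
        (use 1 in \<open>auto simp: exp_flat_def\<close>)
    with 1 show ?thesis by (simp add: exp_flat_def)
  next
    case 2
    \<comment> \<open>The difference quotient at \<open>0\<close> lies in the same family, so it tends to \<open>0\<close>.\<close>
    have "(\<lambda>h. exp_flat q h / h) = exp_flat (pCons 0 q)"
      by (auto simp: exp_flat_def fun_eq_iff)
    then have "((\<lambda>h. (exp_flat q (0 + h) - exp_flat q 0) / h) \<longlongrightarrow> 0) (at 0)"
      using exp_flat_tendsto_0[of "pCons 0 q"] by (simp add: exp_flat_def)
    with 2 show ?thesis by (simp add: DERIV_def exp_flat_def)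
  next
    case 3
    have "((\<lambda>t. poly q (1 / t) * exp (- 1 / t)) has_real_derivative
        poly ([:0, 0, 1:] * (q - pderiv q)) (1 / t) * exp (- 1 / t)) (at t)"
    proof -
      have inv: "((\<lambda>t. 1 / t) has_real_derivative - (1 / t)\<^sup>2) (at t)"
        using 3 by (auto intro!: derivative_eq_intros simp: power2_eq_square)
      have "((\<lambda>t. exp (- 1 / t)) has_real_derivative exp (- 1 / t) * (1 / t)\<^sup>2) (at t)"
        using DERIV_fun_exp[OF DERIV_minus[OF inv]] by simp
      from DERIV_mult[OF DERIV_chain2[OF poly_DERIV inv] this] show ?thesis
        by (rule DERIV_cong) (simp add: power2_eq_square algebra_simps)
    qed
    then have "(exp_flat q has_real_derivative
        poly ([:0, 0, 1:] * (q - pderiv q)) (1 / t) * exp (- 1 / t)) (at t)"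
      by (rule has_field_derivative_transform_within_open[where S = "{0<..}"])
        (use 3 in \<open>auto simp: exp_flat_def\<close>)
    with 3 show ?thesis by (simp add: exp_flat_def)
  qed
qed

text \<open>
  A supply of smooth functions given by their construction rather than by their derivatives: each
  rule differentiates to a function built by the same rules, so that a single differentiation step,
  by induction on the construction, gives derivatives of all orders.
\<close>

inductive elem_smooth :: "(real \<Rightarrow> real) \<Rightarrow> bool" where
  const: "elem_smooth (\<lambda>_. c)"
| ident: "elem_smooth (\<lambda>t. t)"
| exp_flat: "elem_smooth (exp_flat q)"
| add: "elem_smooth f \<Longrightarrow> elem_smooth g \<Longrightarrow> elem_smooth (\<lambda>t. f t + g t)"
| mult: "elem_smooth f \<Longrightarrow> elem_smooth g \<Longrightarrow> elem_smooth (\<lambda>t. f t * g t)"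
| inverse: "elem_smooth f \<Longrightarrow> (\<And>t. f t \<noteq> 0) \<Longrightarrow> elem_smooth (\<lambda>t. inverse (f t))"
| affine: "elem_smooth f \<Longrightarrow> elem_smooth (\<lambda>t. f (a * t + b))"

lemma elem_smooth_has_derivative:
  assumes "elem_smooth f"
  shows "\<exists>f'. elem_smooth f' \<and> (\<forall>t. (f has_real_derivative f' t) (at t))"
  using assms
proof induction
  case (const c)
  show ?case by (intro exI[of _ "\<lambda>_. 0"]) (auto intro: elem_smooth.const)
next
  case ident
  show ?case by (intro exI[of _ "\<lambda>_. 1"]) (auto intro: elem_smooth.const)
next
  case (exp_flat q)
  show ?case
    by (intro exI[of _ "exp_flat ([:0, 0, 1:] * (q - pderiv q))"] conjI allI
        elem_smooth.exp_flat exp_flat_deriv)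
next
  case (add f g)
  then obtain f' g' where "elem_smooth f'" "elem_smooth g'"
    and "\<And>t. (f has_real_derivative f' t) (at t)" "\<And>t. (g has_real_derivative g' t) (at t)"
    by blast
  then show ?case
    by (intro exI[of _ "\<lambda>t. f' t + g' t"]) (auto intro: elem_smooth.add DERIV_add)
next
  case (mult f g)
  then obtain f' g' where "elem_smooth f'" "elem_smooth g'"
    and "\<And>t. (f has_real_derivative f' t) (at t)" "\<And>t. (g has_real_derivative g' t) (at t)"
    by blast
  with mult show ?case
    by (intro exI[of _ "\<lambda>t. f' t * g t + g' t * f t"])
      (auto intro: elem_smooth.add elem_smooth.mult DERIV_mult)
next
  case (inverse f)
  then obtain f' where f': "elem_smooth f'" "\<And>t. (f has_real_derivative f' t) (at t)" by blast
  have "((\<lambda>t. inverse (f t)) has_real_derivative (-1) * (f' t * (inverse (f t) * inverse (f t)))) (at t)" for t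
    using DERIV_inverse_fun[OF f'(2)[of t] inverse.hyps(2)]
    by (simp add: power2_eq_square)
  with inverse f' show ?case
    by (intro exI[of _ "\<lambda>t. (-1) * (f' t * (inverse (f t) * inverse (f t)))"] conjI allI
      elem_smooth.mult elem_smooth.inverse elem_smooth.const)
next
  case (affine f a b)
  then obtain f' where f': "elem_smooth f'" "\<And>t. (f has_real_derivative f' t) (at t)" by blast
  have "((\<lambda>t. f (a * t + b)) has_real_derivative f' (a * t + b) * a) (at t)" for t
    by (rule DERIV_chain2[OF f'(2)]) (auto intro!: derivative_eq_intros)
  with f' show ?case
    by (intro exI[of _ "\<lambda>t. f' (a * t + b) * a"])
      (simp add: elem_smooth.mult elem_smooth.affine elem_smooth.const)
qed

lemma elem_smooth_deriv:
  assumes "elem_smooth f"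
  shows "elem_smooth (deriv f)" "(f has_real_derivative deriv f t) (at t)"
proof -
  obtain f' where f': "elem_smooth f'" "\<And>t. (f has_real_derivative f' t) (at t)"
    using elem_smooth_has_derivative[OF assms] by blast
  then have "deriv f = f'" by (auto intro: DERIV_imp_deriv)
  with f' show "elem_smooth (deriv f)" "(f has_real_derivative deriv f t) (at t)" by auto
qed

lemma elem_smooth_higher_deriv: "elem_smooth f \<Longrightarrow> elem_smooth ((deriv ^^ n) f)"
  by (induction n) (auto intro: elem_smooth_deriv)

lemma higher_deriv_cong:
  fixes f g :: "real \<Rightarrow> real"
  assumes "open S" "x \<in> S" "\<And>t. t \<in> S \<Longrightarrow> f t = g t"
  shows "(deriv ^^ n) f x = (deriv ^^ n) g x"
  using assms(2)
proof (induction n arbitrary: x)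
  case (Suc n)
  have "eventually (\<lambda>t. (deriv ^^ n) f t = (deriv ^^ n) g t) (nhds x)"
    using Suc assms(1) eventually_nhds by blast
  then show ?case by (simp add: deriv_cong_ev)
qed (use assms in auto)

lemma higher_deriv_zero: "(deriv ^^ n) (\<lambda>_::real. 0::real) = (\<lambda>_. 0)"
  by (induction n) auto

text \<open>
  The factor \<open>1 / fact a\<close> makes the derivative of a monomial the preceding one, and all jets at
  \<open>c\<close> become unit vectors.
\<close>

lemma higher_deriv_monomial:
  fixes c :: real
  shows "(deriv ^^ n) (\<lambda>t. (t - c) ^ a / fact a) c = (if n = a then 1 else 0)"
proof (induction n arbitrary: a)
  case 0
  then show ?case by (cases a) auto
next
  case (Suc n)
  show ?case
  proof (cases a)
    case 0
    then have "deriv (\<lambda>t. (t - c) ^ a / fact a) = (\<lambda>_. 0)" by auto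
    with 0 show ?thesis by (simp add: funpow_Suc_right higher_deriv_zero del: funpow.simps)
  next
    case (Suc b)
    have "deriv (\<lambda>t. (t - c) ^ a / fact a) = (\<lambda>t. (t - c) ^ b / fact b)"
    proof
      fix t
      have "((\<lambda>t. (t - c) ^ a / fact a) has_real_derivative
          (real (Suc b) * (t - c) ^ b) / fact (Suc b)) (at t)"
        unfolding Suc by (rule derivative_eq_intros refl | simp)+
      moreover have "(real (Suc b) * (t - c) ^ b) / fact (Suc b) = (t - c) ^ b / fact b"
        by (simp add: field_simps del: of_nat_Suc)
      ultimately show "deriv (\<lambda>t. (t - c) ^ a / fact a) t = (t - c) ^ b / fact b"
        using DERIV_imp_deriv by metis
    qed
    with Suc Suc.IH show ?thesis by (simp add: funpow_Suc_right del: funpow.simps)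
  qed
qed

lemma elem_smooth_power: "elem_smooth f \<Longrightarrow> elem_smooth (\<lambda>t. f t ^ n)"
  by (induction n) (auto intro: elem_smooth.const elem_smooth.mult)

text \<open>
  The quotient \<open>g t / (g t + g (1 - t))\<close>, where \<open>g\<close> is flat on the negative axis: the numerator
  vanishes for \<open>t \<le> 0\<close>, the second summand of the denominator for \<open>t \<ge> 1\<close>, and they never
  vanish together.
\<close>

lemma elem_smooth_step:
  "\<exists>s. elem_smooth s \<and> (\<forall>t. 0 \<le> s t) \<and> (\<forall>t\<le>0. s t = 0) \<and> (\<forall>t\<ge>1. s t = 1)"
proof -
  let ?g = "exp_flat 1"
  define s where "s t = ?g t * inverse (?g t + ?g ((-1) * t + 1))" for t
  have g: "?g t \<ge> 0" "t > 0 \<Longrightarrow> ?g t > 0" "t \<le> 0 \<Longrightarrow> ?g t = 0" for t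
    by (auto simp: exp_flat_def)
  have pos: "?g t + ?g ((-1) * t + 1) > 0" for t
    using g[of t] g[of "(-1) * t + 1"] by (cases "t > 0") (auto intro: add_pos_nonneg add_nonneg_pos)
  have "elem_smooth s"
    unfolding s_def
    by (intro elem_smooth.mult elem_smooth.inverse elem_smooth.add elem_smooth.exp_flat
        elem_smooth.affine[OF elem_smooth.exp_flat] less_imp_neq[OF pos, symmetric])
  moreover have "0 \<le> s t" for t
    using g(1)[of t] pos[of t] by (simp add: s_def)
  moreover have "s t = 0" if "t \<le> 0" for t
    using g(3)[OF that] by (simp add: s_def)
  moreover have "s t = 1" if "t \<ge> 1" for t
    using g(2)[of t] g(3)[of "(-1) * t + 1"] that by (simp add: s_def)
  ultimately show ?thesis by blast
qed

lemma elem_smooth_plateau: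
  fixes a b c :: real
  assumes "a < c" "c < b"
  obtains p S where "elem_smooth p" "\<And>t. 0 \<le> p t" "\<And>t. t \<notin> {a<..<b} \<Longrightarrow> p t = 0"
    "open S" "c \<in> S" "\<And>t. t \<in> S \<Longrightarrow> p t = 1"
proof -
  obtain s where s: "elem_smooth s" "\<And>t. 0 \<le> s t" "\<And>t. t \<le> 0 \<Longrightarrow> s t = 0" "\<And>t. t \<ge> 1 \<Longrightarrow> s t = 1"
    using elem_smooth_step by blast
  \<comment> \<open>The slopes let the two steps rise over half of the distance from \<open>a\<close> or \<open>b\<close> to \<open>c\<close>, which
     leaves a neighbourhood of \<open>c\<close> where both equal 1.\<close>
  define u v where "u = 2 / (c - a)" and "v = 2 / (b - c)"
  have uv: "u > 0" "v > 0" using assms by (auto simp: u_def v_def)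
  define p where "p t = s (u * t + (- u * a)) * s ((- v) * t + v * b)" for t
  have sc: "u * t + (- u * a) = u * (t - a)" "(- v) * t + v * b = v * (b - t)" for t
    by (auto simp: algebra_simps)
  show ?thesis
  proof (rule that[of p "{(a + c) / 2 <..< (c + b) / 2}"])
    show "elem_smooth p"
      unfolding p_def by (intro elem_smooth.mult elem_smooth.affine[OF s(1)])
    show "0 \<le> p t" for t by (simp add: p_def s(2))
    show "p t = 0" if "t \<notin> {a<..<b}" for t
    proof -
      have "u * (t - a) \<le> 0 \<or> v * (b - t) \<le> 0"
        using that uv by (auto simp: mult_le_0_iff)
      then show ?thesis unfolding p_def sc using s(3) by auto
    qed
    show "p t = 1" if "t \<in> {(a + c) / 2 <..< (c + b) / 2}" for t
    proof -
      have "u * (t - a) \<ge> 1" "v * (b - t) \<ge> 1"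
        using that assms by (auto simp: u_def v_def field_simps)
      then show ?thesis unfolding p_def sc using s(4) by auto
    qed
  qed (use assms in auto)
qed

text \<open>
  A monomial centred at \<open>c\<close> times a plateau that equals 1 near \<open>c\<close>: the cut-off does not
  affect any derivative at \<open>c\<close>.
\<close>

lemma elem_smooth_prescribed_jet:
  fixes a b c :: real
  assumes "a < c" "c < b"
  obtains h where "elem_smooth h" "\<And>t. t \<notin> {a<..<b} \<Longrightarrow> h t = 0"
    "\<And>n. (deriv ^^ n) h c = (if n = k then 1 else 0)"
proof -
  obtain p S where p: "elem_smooth p" "\<And>t. t \<notin> {a<..<b} \<Longrightarrow> p t = 0"
    "open S" "c \<in> S" "\<And>t. t \<in> S \<Longrightarrow> p t = 1"
    using elem_smooth_plateau[OF assms] by metis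
  define h where "h t = inverse (fact k) * (1 * t + (- c)) ^ k * p t" for t
  show ?thesis
  proof (rule that[of h])
    show "elem_smooth h"
      unfolding h_def
      by (intro elem_smooth.mult elem_smooth.const elem_smooth_power p(1)
          elem_smooth.affine[OF elem_smooth.ident])
    show "h t = 0" if "t \<notin> {a<..<b}" for t using p(2)[OF that] by (simp add: h_def)
    show "(deriv ^^ n) h c = (if n = k then 1 else 0)" for n
    proof -
      have "(deriv ^^ n) h c = (deriv ^^ n) (\<lambda>t. (t - c) ^ k / fact k) c"
        by (rule higher_deriv_cong[OF p(3,4)]) (simp add: h_def p(5) field_simps)
      then show ?thesis by (simp add: higher_deriv_monomial)
    qed
  qed
qed

section \<open>Sums of tensor products\<close>

text \<open>
  Products of functions of the single coordinates reduce partial derivatives to ordinary ones.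
  The sum over \<open>F\<close> serves for functions that are concentrated near several points; it commutes with
  the partial derivatives by construction.
\<close>

definition tensor_sum :: "'a set \<Rightarrow> ('a \<Rightarrow> 'd::finite \<Rightarrow> real \<Rightarrow> real) \<Rightarrow> real^'d \<Rightarrow> real" where
  "tensor_sum F h y = (\<Sum>x\<in>F. \<Prod>i\<in>UNIV. h x i (y $ i))"

lemma partial_deriv_tensor_sum:
  fixes h :: "'a \<Rightarrow> 'd::finite \<Rightarrow> real \<Rightarrow> real"
  assumes "\<And>x j. x \<in> F \<Longrightarrow> elem_smooth (h x j)"
  shows "partial_deriv i (tensor_sum F h) = tensor_sum F (\<lambda>x. (h x)(i := deriv (h x i)))"
proof
  fix y :: "real^'d"
  define C where "C x = (\<Prod>j\<in>UNIV - {i}. h x j (y $ j))" for x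
  have split: "(\<Prod>j\<in>UNIV. g j) = g i * (\<Prod>j\<in>UNIV - {i}. g j)" for g :: "'d \<Rightarrow> real"
    by (rule prod.remove) auto
  have "(\<Prod>j\<in>UNIV. h x j ((y + t *\<^sub>R axis i 1) $ j)) = h x i (y $ i + t) * C x" for x t
    unfolding split[of "\<lambda>j. h x j ((y + t *\<^sub>R axis i 1) $ j)"] C_def
    by (simp add: axis_def)
  then have line: "(\<lambda>t. tensor_sum F h (y + t *\<^sub>R axis i 1)) = (\<lambda>t. \<Sum>x\<in>F. h x i (y $ i + t) * C x)"
    by (simp add: tensor_sum_def)
  have "((\<lambda>t. h x i (y $ i + t) * C x) has_real_derivative deriv (h x i) (y $ i) * C x) (at 0)"
    if "x \<in> F" for x
  proof -
    have "((\<lambda>t. h x i (y $ i + t)) has_real_derivative deriv (h x i) (y $ i + 0) * 1) (at 0)"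
      by (rule DERIV_chain2[OF elem_smooth_deriv(2)[OF assms[OF that]]])
        (auto intro!: derivative_eq_intros)
    from DERIV_cmult_right[OF this, of "C x"] show ?thesis by simp
  qed
  then have "((\<lambda>t. \<Sum>x\<in>F. h x i (y $ i + t) * C x) has_real_derivative
      (\<Sum>x\<in>F. deriv (h x i) (y $ i) * C x)) (at 0)"
    by (rule DERIV_sum)
  then have "partial_deriv i (tensor_sum F h) y = (\<Sum>x\<in>F. deriv (h x i) (y $ i) * C x)"
    unfolding partial_deriv_def line by (rule DERIV_imp_deriv)
  also have "\<dots> = tensor_sum F (\<lambda>x. (h x)(i := deriv (h x i))) y"
    unfolding tensor_sum_def split C_def by simp
  finally show "partial_deriv i (tensor_sum F h) y
      = tensor_sum F (\<lambda>x. (h x)(i := deriv (h x i))) y" .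
qed

abbreviation tensor_deriv where
  "tensor_deriv F h \<beta> \<equiv> tensor_sum F (\<lambda>x i. (deriv ^^ \<beta> i) (h x i))"

context
  fixes F :: "'a set" and h :: "'a \<Rightarrow> 'd::finite \<Rightarrow> real \<Rightarrow> real"
  assumes smooth: "\<And>x j. x \<in> F \<Longrightarrow> elem_smooth (h x j)"
begin

lemma partial_deriv_tensor_deriv:
  "partial_deriv i (tensor_deriv F h \<beta>) = tensor_deriv F h (\<beta>(i := Suc (\<beta> i)))"
proof -
  have "(\<lambda>x. (\<lambda>j. (deriv ^^ \<beta> j) (h x j))(i := deriv ((deriv ^^ \<beta> i) (h x i)))) =
      (\<lambda>x j. (deriv ^^ (\<beta>(i := Suc (\<beta> i))) j) (h x j))"
    by (auto simp: fun_eq_iff)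
  then show ?thesis
    by (subst partial_deriv_tensor_sum) (auto intro: elem_smooth_higher_deriv smooth)
qed

lemma partial_deriv_power_tensor_deriv:
  "(partial_deriv i ^^ n) (tensor_deriv F h \<beta>) = tensor_deriv F h (\<beta>(i := \<beta> i + n))"
proof (induction n)
  case (Suc n)
  have "(\<beta>(i := \<beta> i + n))(i := Suc ((\<beta>(i := \<beta> i + n)) i)) = \<beta>(i := \<beta> i + Suc n)"
    by (simp add: fun_eq_iff)
  then show ?case
    using partial_deriv_tensor_deriv[of i "\<beta>(i := \<beta> i + n)"] by (simp only: funpow.simps o_apply Suc)
qed simp

lemma smooth_on_tensor_deriv: "smooth_on U (tensor_deriv F h \<beta>)"
proof -
  have "(\<lambda>y. (\<Prod>i\<in>UNIV. (deriv ^^ \<gamma> i) (h x i) (y $ i))) differentiable (at y within U)"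
    if "x \<in> F" for x y \<gamma>
  proof -
    have "((\<lambda>y. (deriv ^^ \<gamma> i) (h x i) (y $ i)) has_derivative
        (\<lambda>v. deriv ((deriv ^^ \<gamma> i) (h x i)) (y $ i) * (v $ i))) (at y within U)" for i
    proof -
      have "((deriv ^^ \<gamma> i) (h x i) has_derivative
          (*) (deriv ((deriv ^^ \<gamma> i) (h x i)) (y $ i))) (at (y $ i))"
        unfolding has_field_derivative_def[symmetric]
        by (intro elem_smooth_deriv(2) elem_smooth_higher_deriv smooth that)
      from has_derivative_compose[OF bounded_linear_imp_has_derivative[OF bounded_linear_vec_nth] this]
      show ?thesis .
    qed
    then show ?thesis
      unfolding differentiable_def by (intro exI) (rule has_derivative_prod)
  qed
  then have diff: "tensor_deriv F h \<gamma> differentiable_on U" for \<gamma>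
    unfolding differentiable_on_def tensor_sum_def[abs_def]
    by (cases "finite F") (simp_all add: differentiable_sum)
  have iter: "\<exists>\<gamma>. foldr partial_deriv is (tensor_deriv F h \<beta>) = tensor_deriv F h \<gamma>" for "is"
  proof (induction "is")
    case (Cons i "is")
    then obtain \<gamma> where "foldr partial_deriv is (tensor_deriv F h \<beta>) = tensor_deriv F h \<gamma>"
      by blast
    then show ?case
      by (intro exI[of _ "\<gamma>(i := Suc (\<gamma> i))"]) (simp only: foldr.simps o_apply partial_deriv_tensor_deriv)
  qed auto
  show ?thesis
    unfolding smooth_on_def
  proof
    fix "is"
    obtain \<gamma> where "foldr partial_deriv is (tensor_deriv F h \<beta>) = tensor_deriv F h \<gamma>"
      using iter by blast
    with diff[of \<gamma>] show "foldr partial_deriv is (tensor_deriv F h \<beta>) differentiable_on U"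
      by simp
  qed
qed

end

text \<open>
  Each coordinate occurs once in the list over which \<open>multi_deriv\<close> folds, and differentiating in
  one coordinate leaves the other factors alone.
\<close>

lemma multi_deriv_tensor_sum:
  assumes "\<And>x j. x \<in> F \<Longrightarrow> elem_smooth (h x j)"
  shows "multi_deriv \<alpha> (tensor_sum F h) = tensor_deriv F h (\<lambda>i. \<alpha> $ i)"
proof -
  have "foldr (\<lambda>i. partial_deriv i ^^ (\<alpha> $ i)) is (tensor_deriv F h (\<lambda>_. 0)) =
      tensor_deriv F h (\<lambda>i. if i \<in> set is then \<alpha> $ i else 0)" if "distinct is" for "is"
    using that
  proof (induction "is")
    case (Cons i "is")
    let ?\<beta> = "\<lambda>j. if j \<in> set is then \<alpha> $ j else 0"
    have "foldr (\<lambda>i. partial_deriv i ^^ (\<alpha> $ i)) (i # is) (tensor_deriv F h (\<lambda>_. 0)) =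
        (partial_deriv i ^^ (\<alpha> $ i)) (tensor_deriv F h ?\<beta>)"
      using Cons by simp
    also have "\<dots> = tensor_deriv F h (?\<beta>(i := ?\<beta> i + \<alpha> $ i))"
      by (rule partial_deriv_power_tensor_deriv[OF assms])
    also have "?\<beta>(i := ?\<beta> i + \<alpha> $ i) = (\<lambda>j. if j \<in> set (i # is) then \<alpha> $ j else 0)"
      using Cons.prems by (auto simp: fun_eq_iff)
    finally show ?case .
  qed simp
  from this[of "sorted_list_of_set UNIV"] show ?thesis
    by (simp add: multi_deriv_def)
qed

section \<open>Spaces of test functions\<close>

lemma Cc_smoothI:
  assumes "smooth_on U f" "compact K" "K \<subseteq> U" "\<And>x. x \<in> U - K \<Longrightarrow> f x = 0"
  shows "f \<in> Cc_smooth U"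
proof -
  have "closure (support_on U f) \<subseteq> K"
    using assms by (intro closure_minimal compact_imp_closed) (auto simp: support_on_def)
  then have "U \<inter> closure (support_on U f) = K \<inter> closure (support_on U f)"
    using assms(3) by blast
  with assms show ?thesis by (simp add: Cc_smooth_def compact_Int_closed)
qed

lemma Cc_smoothE:
  assumes "f \<in> Cc_smooth U"
  obtains K where "smooth_on U f" "compact K" "K \<subseteq> U" "\<And>x. x \<in> U - K \<Longrightarrow> f x = 0"
proof (rule that[of "U \<inter> closure (support_on U f)"])
  show "f x = 0" if "x \<in> U - U \<inter> closure (support_on U f)" for x
    using that closure_subset[of "support_on U f"] by (auto simp: support_on_def)
qed (use assms in \<open>auto simp: Cc_smooth_def\<close>)

text \<open>
  Linearity holds only on \<open>U\<close>, where the functions are differentiable; the induction step uses that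
  a short segment through \<open>x\<close> stays in the open set \<open>U\<close>.
\<close>

lemma foldr_partial_deriv_lincomb:
  assumes "open U" "smooth_on U f" "smooth_on U g" "x \<in> U"
  shows "foldr partial_deriv is (\<lambda>x. f x + a * g x) x
       = foldr partial_deriv is f x + a * foldr partial_deriv is g x"
  using assms(4)
proof (induction "is" arbitrary: x)
  case (Cons i "is")
  let ?F = "foldr partial_deriv is f" and ?G = "foldr partial_deriv is g"
  let ?l = "\<lambda>t::real. x + t *\<^sub>R axis i 1"
  have lin: "\<exists>d. ((\<lambda>t. H (?l t)) has_real_derivative d) (at 0)"
    if "H differentiable_on U" for H :: "real^'a \<Rightarrow> real"
  proof -
    have "H differentiable at (?l 0)"
      using that assms(1) Cons.prems by (simp add: differentiable_on_eq_differentiable_at)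
    then obtain H' where "(H has_derivative H') (at (?l 0))" by (auto simp: differentiable_def)
    moreover have "(?l has_derivative (\<lambda>t. t *\<^sub>R axis i 1)) (at 0)"
      by (auto intro!: derivative_eq_intros)
    ultimately have "((\<lambda>t. H (?l t)) has_derivative (\<lambda>t. H' (t *\<^sub>R axis i 1))) (at 0)"
      using has_derivative_compose by blast
    then have "(\<lambda>t. H (?l t)) differentiable (at 0)" by (auto simp: differentiable_def)
    then show ?thesis by (simp add: real_differentiable_def)
  qed
  obtain p where p: "((\<lambda>t. ?F (?l t)) has_real_derivative p) (at 0)"
    using lin assms(2) unfolding smooth_on_def by blast
  obtain q where q: "((\<lambda>t. ?G (?l t)) has_real_derivative q) (at 0)"
    using lin assms(3) unfolding smooth_on_def by blast
  have "eventually (\<lambda>t. ?l t \<in> U) (nhds 0)"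
  proof -
    have "(?l \<longlongrightarrow> ?l 0) (nhds 0)"
      by (intro tendsto_intros filterlim_ident)
    then show ?thesis
      using assms(1) Cons.prems by (intro topological_tendstoD) auto
  qed
  then have ev: "eventually (\<lambda>t. foldr partial_deriv is (\<lambda>x. f x + a * g x) (?l t)
      = ?F (?l t) + a * ?G (?l t)) (nhds 0)"
    by (rule eventually_mono) (rule Cons.IH)
  have "deriv (\<lambda>t. foldr partial_deriv is (\<lambda>x. f x + a * g x) (?l t)) 0
      = deriv (\<lambda>t. ?F (?l t) + a * ?G (?l t)) 0"
    using ev by (rule deriv_cong_ev) simp
  also have "\<dots> = p + a * q"
    by (intro DERIV_imp_deriv DERIV_add DERIV_cmult p q)
  finally show ?case
    using DERIV_imp_deriv[OF p] DERIV_imp_deriv[OF q]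
    unfolding foldr.simps o_apply partial_deriv_def[of i _ x] by simp
qed simp

lemma smooth_on_lincomb:
  assumes "open U" "smooth_on U f" "smooth_on U g"
  shows "smooth_on U (\<lambda>x. f x + a * g x)"
  unfolding smooth_on_def
proof
  fix "is"
  have "(\<lambda>x. foldr partial_deriv is f x + a * foldr partial_deriv is g x) differentiable_on U"
    using assms unfolding smooth_on_def
    by (intro differentiable_on_add differentiable_on_mult differentiable_on_const) auto
  moreover have "foldr partial_deriv is f x + a * foldr partial_deriv is g x
      = foldr partial_deriv is (\<lambda>x. f x + a * g x) x" if "x \<in> U" for x
    using foldr_partial_deriv_lincomb[OF assms that] by simp
  ultimately show "foldr partial_deriv is (\<lambda>x. f x + a * g x) differentiable_on U"
    using differentiable_transform_within[OF _ zero_less_one]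
    unfolding differentiable_on_def by blast
qed

lemma Cc_smooth_vec_lincomb:
  assumes "open U" "\<phi> \<in> Cc_smooth_vec U" "\<psi> \<in> Cc_smooth_vec U"
  shows "(\<lambda>x. \<phi> x + a *\<^sub>R \<psi> x) \<in> Cc_smooth_vec U"
proof -
  have "(\<lambda>x. f x + a * g x) \<in> Cc_smooth U" if f: "f \<in> Cc_smooth U" and g: "g \<in> Cc_smooth U" for f g
  proof -
    obtain K where K: "smooth_on U f" "compact K" "K \<subseteq> U" "\<And>x. x \<in> U - K \<Longrightarrow> f x = 0"
      using Cc_smoothE[OF f] by blast
    obtain L where L: "smooth_on U g" "compact L" "L \<subseteq> U" "\<And>x. x \<in> U - L \<Longrightarrow> g x = 0"
      using Cc_smoothE[OF g] by blast
    show ?thesis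
      using K L smooth_on_lincomb[OF assms(1) K(1) L(1)]
      by (intro Cc_smoothI[where K = "K \<union> L"]) auto
  qed
  with assms(2,3) show ?thesis by (simp add: Cc_smooth_vec_def)
qed

lemma continuous_on_multi_deriv:
  assumes "smooth_on U f"
  shows "continuous_on U (multi_deriv \<alpha> f)"
proof -
  have "\<exists>js. foldr (\<lambda>i. partial_deriv i ^^ (\<alpha> $ i)) is f = foldr partial_deriv js f" for "is"
  proof (induction "is")
    case Nil
    show ?case by (intro exI[of _ "[]"]) simp
  next
    case (Cons i "is")
    then obtain js where "foldr (\<lambda>i. partial_deriv i ^^ (\<alpha> $ i)) is f = foldr partial_deriv js f"
      by blast
    moreover have "(partial_deriv i ^^ n) g = foldr partial_deriv (replicate n i) g" for n g
      by (induction n) auto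
    ultimately show ?case
      by (intro exI[of _ "replicate (\<alpha> $ i) i @ js"]) simp
  qed
  then obtain js where "multi_deriv \<alpha> f = foldr partial_deriv js f"
    unfolding multi_deriv_def by blast
  moreover have "foldr partial_deriv js f differentiable_on U"
    using assms unfolding smooth_on_def by blast
  ultimately show ?thesis
    by (simp add: differentiable_imp_continuous_on)
qed

text \<open>
  Every point of \<open>F\<close> gets its own box, which contains no other point of \<open>F\<close>, and a tensor product of
  one-dimensional functions that vanishes outside the box and has the wanted jet at the point. At
  a point of \<open>F\<close> the summands of the other points vanish together with all their derivatives.
\<close>

lemma Cc_smooth_vec_with_jets:
  fixes U F :: "(real^'d::{finite,linorder}) set"
    and \<alpha> :: "real^'d::{finite,linorder} \<Rightarrow> nat^'d::{finite,linorder}"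
    and j :: "real^'d::{finite,linorder} \<Rightarrow> 'n::finite"
  assumes "open U" "finite F" "F \<subseteq> U"
  obtains \<phi> where "\<phi> \<in> Cc_smooth_vec U"
    "\<And>x \<beta> l. x \<in> F \<Longrightarrow>
       multi_deriv \<beta> (\<lambda>y. \<phi> y $ l) x = (if \<beta> = \<alpha> x \<and> l = j x then 1 else 0)"
proof -
  have "\<forall>x\<in>F. \<exists>ab. x \<in> box (fst ab) (snd ab) \<and> cbox (fst ab) (snd ab) \<subseteq> U - (F - {x})"
  proof
    fix x assume "x \<in> F"
    moreover have "open (U - (F - {x}))"
      using assms finite_imp_closed by blast
    ultimately obtain a b where "cbox a b \<subseteq> U - (F - {x})" "x \<in> box a b"
      using assms(3) by (meson DiffD2 DiffI insertI1 open_contains_cbox subsetD)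
    then show "\<exists>ab. x \<in> box (fst ab) (snd ab) \<and> cbox (fst ab) (snd ab) \<subseteq> U - (F - {x})"
      by (intro exI[of _ "(a, b)"]) simp
  qed
  then obtain ab where ab: "\<And>x. x \<in> F \<Longrightarrow> x \<in> box (fst (ab x)) (snd (ab x))"
    "\<And>x. x \<in> F \<Longrightarrow> cbox (fst (ab x)) (snd (ab x)) \<subseteq> U - (F - {x})"
    by metis
  define a where "a x = fst (ab x)" for x
  define b where "b x = snd (ab x)" for x
  have a_less: "a x $ i < x $ i" "x $ i < b x $ i" if "x \<in> F" for x i
    using ab(1)[OF that] by (auto simp: a_def b_def mem_box_cart)
  have sub: "cbox (a x) (b x) \<subseteq> U - (F - {x})" if "x \<in> F" for x
    using ab(2)[OF that] by (simp add: a_def b_def)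
  \<comment> \<open>The one-dimensional factor for the point \<open>x\<close> in coordinate \<open>i\<close>.\<close>
  define good where "good x i g \<longleftrightarrow> elem_smooth g \<and> (\<forall>t. t \<notin> {a x $ i <..< b x $ i} \<longrightarrow> g t = 0)
      \<and> (\<forall>n. (deriv ^^ n) g (x $ i) = (if n = \<alpha> x $ i then 1 else 0))" for x i g
  define h where "h x i = (SOME g. good x i g)" for x i
  have "good x i (h x i)" if x: "x \<in> F" for x i
  proof -
    obtain g where "good x i g"
      unfolding good_def
      using elem_smooth_prescribed_jet[OF a_less(1)[OF x, of i] a_less(2)[OF x, of i], of "\<alpha> x $ i"]
      by metis
    then show ?thesis unfolding h_def by (rule someI[of "good x i"])
  qed
  then have h: "elem_smooth (h x i)" "t \<notin> {a x $ i <..< b x $ i} \<Longrightarrow> h x i t = 0"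
    "(deriv ^^ n) (h x i) (x $ i) = (if n = \<alpha> x $ i then 1 else 0)" if "x \<in> F" for x i t n
    using that unfolding good_def by blast+
  have h0: "(deriv ^^ n) (h x i) t = 0" if "x \<in> F" "t \<notin> {a x $ i..b x $ i}" for x i t n
  proof -
    have "(deriv ^^ n) (h x i) t = (deriv ^^ n) (\<lambda>_. 0) t"
      using that h(2)[OF that(1)] by (intro higher_deriv_cong[of "- {a x $ i..b x $ i}"]) auto
    then show ?thesis by (simp add: higher_deriv_zero)
  qed
  define \<phi> where "\<phi> y = (\<chi> l. tensor_sum {x \<in> F. j x = l} h y)" for y
  show ?thesis
  proof (rule that[of \<phi>])
    have "tensor_sum G h \<in> Cc_smooth U" if "G \<subseteq> F" for G
    proof (rule Cc_smoothI)
      show "smooth_on U (tensor_sum G h)"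
        using smooth_on_tensor_deriv[of G h U "\<lambda>_. 0"] h(1) that by auto
      show "compact (\<Union>x\<in>F. cbox (a x) (b x))"
        using assms(2) by (intro compact_UN) auto
      show "(\<Union>x\<in>F. cbox (a x) (b x)) \<subseteq> U" using sub by blast
      fix y assume y: "y \<in> U - (\<Union>x\<in>F. cbox (a x) (b x))"
      have "(\<Prod>i\<in>UNIV. h x i (y $ i)) = 0" if "x \<in> G" for x
      proof -
        have x: "x \<in> F" using that \<open>G \<subseteq> F\<close> by blast
        then obtain i where "y $ i \<notin> {a x $ i..b x $ i}"
          using y by (auto simp: mem_box_cart)
        then have "h x i (y $ i) = 0" using h0[OF x, of "y $ i" i 0] by simp
        then show ?thesis by (auto intro!: prod_zero)
      qed
      then show "tensor_sum G h y = 0" unfolding tensor_sum_def by (rule sum.neutral[OF ballI])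
    qed
    then show "\<phi> \<in> Cc_smooth_vec U" by (simp add: Cc_smooth_vec_def \<phi>_def)
  next
    fix x \<beta> l assume x: "x \<in> F"
    let ?G = "{x \<in> F. j x = l}"
    have "multi_deriv \<beta> (\<lambda>y. \<phi> y $ l) x =
        (\<Sum>x'\<in>?G. \<Prod>i\<in>UNIV. (deriv ^^ (\<beta> $ i)) (h x' i) (x $ i))"
      using multi_deriv_tensor_sum[of ?G h \<beta>] h(1) by (simp add: \<phi>_def tensor_sum_def[abs_def])
    also have "\<dots> = (\<Sum>x'\<in>?G. if x' = x then if \<beta> = \<alpha> x then 1 else 0 else 0)"
    proof (rule sum.cong[OF refl])
      fix x' assume "x' \<in> ?G"
      then have x': "x' \<in> F" by simp
      have "(\<Prod>i\<in>UNIV. (deriv ^^ (\<beta> $ i)) (h x' i) (x $ i)) = 0" if "x' \<noteq> x"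
      proof -
        have "x \<notin> cbox (a x') (b x')" using sub[OF x'] x that by blast
        then obtain i where "x $ i \<notin> {a x' $ i..b x' $ i}"
          by (auto simp: mem_box_cart)
        then have "(deriv ^^ (\<beta> $ i)) (h x' i) (x $ i) = 0" using h0[OF x'] by simp
        then show ?thesis by (auto intro!: prod_zero)
      qed
      moreover have "(\<Prod>i\<in>UNIV. (deriv ^^ (\<beta> $ i)) (h x i) (x $ i)) = (if \<beta> = \<alpha> x then 1 else 0)"
        by (auto simp: h(3)[OF x] vec_eq_iff intro!: prod_zero)
      ultimately show "(\<Prod>i\<in>UNIV. (deriv ^^ (\<beta> $ i)) (h x' i) (x $ i)) =
          (if x' = x then if \<beta> = \<alpha> x then 1 else 0 else 0)"
        by auto
    qed
    also have "\<dots> = (if \<beta> = \<alpha> x \<and> l = j x then 1 else 0)"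
      using x assms(2) by (auto simp: sum.delta)
    finally show "multi_deriv \<beta> (\<lambda>y. \<phi> y $ l) x = (if \<beta> = \<alpha> x \<and> l = j x then 1 else 0)" .
  qed
qed

section \<open>Operators applied to test functions\<close>

lemma finite_pdo_indices:
  assumes "is_pdo U P"
  shows "finite {\<alpha>. \<exists>y\<in>U. P \<alpha> y \<noteq> 0}"
proof -
  obtain s where s: "\<And>\<alpha> x. multi_order \<alpha> > s \<Longrightarrow> x \<in> U \<Longrightarrow> P \<alpha> x = 0"
    using assms unfolding is_pdo_def by blast
  have "{\<alpha>. \<exists>y\<in>U. P \<alpha> y \<noteq> 0} \<subseteq> vec_lambda ` (PiE UNIV (\<lambda>_. {..s}))"
  proof
    fix \<alpha> assume "\<alpha> \<in> {\<alpha>. \<exists>y\<in>U. P \<alpha> y \<noteq> 0}"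
    then have "multi_order \<alpha> \<le> s" using s not_le by blast
    moreover have "\<alpha> $ i \<le> multi_order \<alpha>" for i
      unfolding multi_order_def by (rule member_le_sum) auto
    ultimately have "vec_nth \<alpha> \<in> PiE UNIV (\<lambda>_. {..s})"
      using order_trans by (auto simp: PiE_def)
    then show "\<alpha> \<in> vec_lambda ` (PiE UNIV (\<lambda>_. {..s}))"
      by (metis image_eqI vec_nth_inverse)
  qed
  then show ?thesis
    by (rule finite_subset) (intro finite_imageI finite_PiE; simp)
qed

text \<open>
  The index set in \<open>pdo_apply\<close> depends on the operator. To compare operators it is enlarged to a common
  finite set, on which the additional coefficients vanish.
\<close>

lemma pdo_apply_eq_sum:
  assumes "finite A" "{\<alpha>. \<exists>y\<in>U. P \<alpha> y \<noteq> 0} \<subseteq> A" "x \<in> U"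
  shows "pdo_apply U P \<phi> x = (\<Sum>\<alpha>\<in>A. P \<alpha> x *v (\<chi> j. multi_deriv \<alpha> (\<lambda>y. \<phi> y $ j) x))"
  unfolding pdo_apply_def using assms
  by (intro sum.mono_neutral_left) auto

lemma pdo_apply_lincomb:
  assumes "finite K" "is_pdo U L" "\<And>k. k \<in> K \<Longrightarrow> is_pdo U (Ls k)"
    and "\<And>\<alpha> x. x \<in> U \<Longrightarrow> L \<alpha> x = (\<Sum>k\<in>K. c k *\<^sub>R Ls k \<alpha> x)" and "x \<in> U"
  shows "pdo_apply U L \<phi> x = (\<Sum>k\<in>K. c k *\<^sub>R pdo_apply U (Ls k) \<phi> x)"
proof -
  let ?I = "\<lambda>P. {\<alpha>. \<exists>y\<in>U. P \<alpha> y \<noteq> 0}"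
  define A where "A = ?I L \<union> (\<Union>k\<in>K. ?I (Ls k))"
  let ?v = "\<lambda>\<alpha>. \<chi> j. multi_deriv \<alpha> (\<lambda>y. \<phi> y $ j) x"
  have A: "finite A"
    unfolding A_def using assms(1-3) by (auto intro!: finite_pdo_indices)
  have "pdo_apply U L \<phi> x = (\<Sum>\<alpha>\<in>A. (\<Sum>k\<in>K. c k *\<^sub>R Ls k \<alpha> x) *v ?v \<alpha>)"
    using pdo_apply_eq_sum[OF A, of U L] assms(4,5) by (auto simp: A_def)
  also have "\<dots> = (\<Sum>\<alpha>\<in>A. \<Sum>k\<in>K. c k *\<^sub>R (Ls k \<alpha> x *v ?v \<alpha>))"
    using assms(1)
    by (intro sum.cong refl, induction K rule: finite_induct)
      (simp_all add: matrix_vector_mult_add_rdistrib scaleR_matrix_vector_assoc)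
  also have "\<dots> = (\<Sum>k\<in>K. c k *\<^sub>R (\<Sum>\<alpha>\<in>A. Ls k \<alpha> x *v ?v \<alpha>))"
    by (subst sum.swap) (simp add: scaleR_sum_right)
  also have "\<dots> = (\<Sum>k\<in>K. c k *\<^sub>R pdo_apply U (Ls k) \<phi> x)"
    using assms(5) by (intro sum.cong refl arg_cong[where f = "(*\<^sub>R) _"]
        pdo_apply_eq_sum[OF A, symmetric]) (auto simp: A_def)
  finally show ?thesis .
qed

lemma continuous_on_pdo_apply:
  assumes "is_pdo U P" "\<phi> \<in> Cc_smooth_vec U"
  shows "continuous_on U (pdo_apply U P \<phi>)"
proof -
  have D: "continuous_on U (multi_deriv \<alpha> (\<lambda>y. \<phi> y $ j))" for \<alpha> j
    using assms(2) by (intro continuous_on_multi_deriv) (auto simp: Cc_smooth_vec_def Cc_smooth_def)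
  have P: "continuous_on U (\<lambda>x. P \<alpha> x $ i $ j)" for \<alpha> i j
    using assms(1) by (intro continuous_on_component) (simp add: is_pdo_def)
  show ?thesis
    unfolding pdo_apply_def[abs_def] matrix_vector_mult_def vec_lambda_beta
    by (intro continuous_on_sum continuous_on_vec_lambda continuous_on_mult P D)
qed

text \<open>
  A test function whose jet at \<open>x\<close> is a unit vector reads off one coefficient of the operator.
\<close>

lemma pdo_apply_jet:
  assumes "is_pdo U P" "x \<in> U"
    and jet: "\<And>\<beta> l. multi_deriv \<beta> (\<lambda>y. \<phi> y $ l) x = (if \<beta> = \<alpha> \<and> l = j then 1 else 0)"
  shows "pdo_apply U P \<phi> x $ i = P \<alpha> x $ i $ j"
proof -
  let ?A = "insert \<alpha> {\<alpha>. \<exists>y\<in>U. P \<alpha> y \<noteq> 0}"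
  have A: "finite ?A" using finite_pdo_indices[OF assms(1)] by simp
  have "pdo_apply U P \<phi> x $ i =
      (\<Sum>\<beta>\<in>?A. \<Sum>l\<in>UNIV. P \<beta> x $ i $ l * (if \<beta> = \<alpha> \<and> l = j then 1 else 0))"
    using pdo_apply_eq_sum[OF A, of U P x \<phi>] assms(2)
    by (simp only: jet sum_component matrix_vector_mult_def vec_lambda_beta subset_insertI)
  also have "\<dots> = (\<Sum>\<beta>\<in>?A. if \<beta> = \<alpha> then P \<alpha> x $ i $ j else 0)"
    by (intro sum.cong refl) (auto simp: if_distrib[of "(*) _"] cong: if_cong)
  also have "\<dots> = P \<alpha> x $ i $ j" using A by (simp add: sum.delta)
  finally show ?thesis .
qed

section \<open>The pairing with test functions\<close>

lemma continuous_on_Cc_smooth: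
  assumes "g \<in> Cc_smooth U"
  shows "continuous_on U g"
proof -
  have "foldr partial_deriv [] g differentiable_on U"
    using assms unfolding Cc_smooth_def smooth_on_def by blast
  then show ?thesis by (simp add: differentiable_imp_continuous_on)
qed

text \<open>
  The function \<open>f\<close> may grow without bound towards the boundary of \<open>U\<close>, but the support of \<open>g\<close>
  cuts the integral down to a compact subset of \<open>U\<close>.
\<close>

lemma set_integrable_mult_Cc_smooth:
  assumes "open U" "continuous_on U f" "g \<in> Cc_smooth U"
  shows "set_integrable lborel U (\<lambda>x. f x * g x)"
proof -
  obtain K where K: "smooth_on U g" "compact K" "K \<subseteq> U" "\<And>x. x \<in> U - K \<Longrightarrow> g x = 0"
    using Cc_smoothE[OF assms(3)] by blast
  have "continuous_on K (\<lambda>x. f x * g x)"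
    using continuous_on_mult[OF assms(2) continuous_on_Cc_smooth[OF assms(3)]] K(3)
    by (rule continuous_on_subset)
  then have "integrable lborel (\<lambda>x. indicator K x *\<^sub>R (f x * g x))"
    using K(2) by (rule borel_integrable_compact[rotated])
  moreover have "(\<lambda>x. indicator K x *\<^sub>R (f x * g x)) = (\<lambda>x. indicator U x *\<^sub>R (f x * g x))"
    using K(3,4) by (force simp: fun_eq_iff indicator_def)
  ultimately show ?thesis by (simp add: set_integrable_def)
qed

lemma Cc_smooth_vec_nth: "\<psi> \<in> Cc_smooth_vec U \<Longrightarrow> (\<lambda>x. \<psi> x $ i) \<in> Cc_smooth U"
  by (simp add: Cc_smooth_vec_def)

lemma inner_on_lincomb_right:
  assumes "open U" "continuous_on U f" "\<phi> \<in> Cc_smooth_vec U" "\<psi> \<in> Cc_smooth_vec U"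
  shows "inner_on U f (\<lambda>x. \<phi> x + a *\<^sub>R \<psi> x) = inner_on U f \<phi> + a * inner_on U f \<psi>"
proof -
  have int: "set_integrable lborel U (\<lambda>x. f x $ i * g x $ i)" if "g \<in> Cc_smooth_vec U" for g i
    using assms(1) continuous_on_component[OF assms(2)] Cc_smooth_vec_nth[OF that]
    by (rule set_integrable_mult_Cc_smooth)
  have "(LINT x:U|lborel. f x $ i * (\<phi> x + a *\<^sub>R \<psi> x) $ i) =
      (LINT x:U|lborel. f x $ i * \<phi> x $ i) + a * (LINT x:U|lborel. f x $ i * \<psi> x $ i)" for i
  proof -
    have "(LINT x:U|lborel. f x $ i * (\<phi> x + a *\<^sub>R \<psi> x) $ i) =
        (LINT x:U|lborel. f x $ i * \<phi> x $ i + a * (f x $ i * \<psi> x $ i))"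
      by (simp add: algebra_simps)
    also have "\<dots> = (LINT x:U|lborel. f x $ i * \<phi> x $ i) + (LINT x:U|lborel. a * (f x $ i * \<psi> x $ i))"
      using int assms(3,4) by (intro set_integral_add set_integrable_mult_right) auto
    finally show ?thesis by simp
  qed
  then show ?thesis by (simp add: inner_on_def sum.distrib sum_distrib_left)
qed

lemma inner_on_lincomb_left:
  assumes "open U" "finite K" "\<And>k. k \<in> K \<Longrightarrow> continuous_on U (f k)" "\<psi> \<in> Cc_smooth_vec U"
    and "\<And>x. x \<in> U \<Longrightarrow> g x = (\<Sum>k\<in>K. c k *\<^sub>R f k x)"
  shows "inner_on U g \<psi> = (\<Sum>k\<in>K. c k * inner_on U (f k) \<psi>)"
proof -
  have int: "set_integrable lborel U (\<lambda>x. f k x $ i * \<psi> x $ i)" if "k \<in> K" for k i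
    using assms(1) continuous_on_component[OF assms(3)[OF that]] Cc_smooth_vec_nth[OF assms(4)]
    by (rule set_integrable_mult_Cc_smooth)
  have "(LINT x:U|lborel. g x $ i * \<psi> x $ i) = (\<Sum>k\<in>K. c k * (LINT x:U|lborel. f k x $ i * \<psi> x $ i))" for i
  proof -
    have "(LINT x:U|lborel. g x $ i * \<psi> x $ i) =
        (LINT x|lborel. (\<Sum>k\<in>K. c k * (indicator U x *\<^sub>R (f k x $ i * \<psi> x $ i))))"
      unfolding set_lebesgue_integral_def
      by (intro Bochner_Integration.integral_cong refl)
        (auto simp: assms(5) sum_distrib_left sum_distrib_right indicator_def mult.assoc)
    also have "\<dots> = (\<Sum>k\<in>K. (LINT x|lborel. c k * (indicator U x *\<^sub>R (f k x $ i * \<psi> x $ i))))"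
      using int unfolding set_integrable_def
      by (intro Bochner_Integration.integral_sum integrable_mult_right) auto
    finally show ?thesis by (simp add: set_lebesgue_integral_def)
  qed
  then have "inner_on U g \<psi> = (\<Sum>i\<in>UNIV. \<Sum>k\<in>K. c k * (LINT x:U|lborel. f k x $ i * \<psi> x $ i))"
    by (simp add: inner_on_def)
  then show ?thesis
    by (subst (asm) sum.swap) (simp add: inner_on_def sum_distrib_left)
qed

text \<open>
  Unlike the functions with prescribed jets, this one has a sign, which the positivity argument for
  \<open>inner_on\<close> requires.
\<close>

lemma Cc_smooth_plateau:
  fixes x0 :: "real^'d::finite"
  assumes "x0 \<in> box a b" "cbox a b \<subseteq> U"
  obtains g where "g \<in> Cc_smooth U" "\<And>y. 0 \<le> g y" "g x0 = 1" "\<And>y. y \<notin> cbox a b \<Longrightarrow> g y = 0"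
proof -
  have "\<forall>i. \<exists>p. elem_smooth p \<and> (\<forall>t. 0 \<le> p t) \<and> (\<forall>t. t \<notin> {a $ i<..<b $ i} \<longrightarrow> p t = 0) \<and> p (x0 $ i) = 1"
  proof
    fix i
    have "a $ i < x0 $ i" "x0 $ i < b $ i" using assms(1) by (auto simp: mem_box_cart)
    then obtain p S where "elem_smooth p" "\<And>t. 0 \<le> p t" "\<And>t. t \<notin> {a $ i<..<b $ i} \<Longrightarrow> p t = 0"
      "open S" "x0 $ i \<in> S" "\<And>t. t \<in> S \<Longrightarrow> p t = 1"
      using elem_smooth_plateau[of "a $ i" "x0 $ i" "b $ i"] by metis
    then show "\<exists>p. elem_smooth p \<and> (\<forall>t. 0 \<le> p t) \<and> (\<forall>t. t \<notin> {a $ i<..<b $ i} \<longrightarrow> p t = 0) \<and> p (x0 $ i) = 1"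
      by blast
  qed
  then obtain p where p: "\<And>i. elem_smooth (p i)" "\<And>i t. 0 \<le> p i t"
    "\<And>i t. t \<notin> {a $ i<..<b $ i} \<Longrightarrow> p i t = 0" "\<And>i. p i (x0 $ i) = 1"
    by metis
  define g where "g = tensor_sum {()} (\<lambda>_. p)"
  have g: "g y = (\<Prod>i\<in>UNIV. p i (y $ i))" for y by (simp add: g_def tensor_sum_def)
  have g0: "g y = 0" if "y \<notin> cbox a b" for y
  proof -
    obtain i where "y $ i \<notin> {a $ i..b $ i}"
      using \<open>y \<notin> cbox a b\<close> by (auto simp: mem_box_cart)
    then have "y $ i \<notin> {a $ i<..<b $ i}" by auto
    then have "p i (y $ i) = 0" by (rule p(3))
    then show ?thesis unfolding g by (auto intro!: prod_zero)
  qed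
  show ?thesis
  proof (rule that[of g])
    have "smooth_on U g"
      using smooth_on_tensor_deriv[of "{()}" "\<lambda>_. p" U "\<lambda>_. 0"] p(1) by (simp add: g_def)
    then show "g \<in> Cc_smooth U"
      using assms(2) g0 by (intro Cc_smoothI[where K = "cbox a b"]) auto
    show "0 \<le> g y" "g x0 = 1" for y by (auto simp: g p intro: prod_nonneg)
  qed (rule g0)
qed

text \<open>
  The fundamental lemma of the calculus of variations: if a component were nonzero at \<open>x0\<close>, it would
  keep its sign on a box around \<open>x0\<close>, and pairing it with a nonnegative bump in that box would give
  a nonzero integral.
\<close>

lemma zero_if_orthogonal_to_Cc_smooth_vec:
  fixes f :: "real^'d::finite \<Rightarrow> real^'m::finite"
  assumes "open U" "continuous_on U f" "\<And>\<psi>. \<psi> \<in> Cc_smooth_vec U \<Longrightarrow> inner_on U f \<psi> = 0" "x0 \<in> U"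
  shows "f x0 = 0"
proof (rule ccontr)
  assume "f x0 \<noteq> 0"
  then obtain i where i: "f x0 $ i \<noteq> 0" by (auto simp: vec_eq_iff)
  \<comment> \<open>The factor \<open>sgn\<close> makes the component positive at \<open>x0\<close>.\<close>
  let ?f = "\<lambda>x. sgn (f x0 $ i) * f x $ i"
  have cf: "continuous_on U ?f"
    by (intro continuous_intros continuous_on_component assms(2))
  have "{x \<in> U. 0 < ?f x} = U \<inter> ?f -` {0<..}" by auto
  then have "open {x \<in> U. 0 < ?f x}"
    using continuous_open_preimage[OF cf assms(1) open_greaterThan] by simp
  moreover have "x0 \<in> {x \<in> U. 0 < ?f x}"
    using assms(4) i by (simp add: sgn_if)
  ultimately obtain a b where ab: "cbox a b \<subseteq> {x \<in> U. 0 < ?f x}" "x0 \<in> box a b"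
    by (rule open_contains_cbox)
  obtain g where g: "g \<in> Cc_smooth U" "\<And>y. 0 \<le> g y" "g x0 = 1" "\<And>y. y \<notin> cbox a b \<Longrightarrow> g y = 0"
    using Cc_smooth_plateau[OF ab(2), of U] ab(1) by blast
  define \<psi> where "\<psi> x = axis i (g x)" for x
  have "(\<lambda>x. 0) \<in> Cc_smooth U"
  proof (rule Cc_smoothI)
    show "smooth_on U (\<lambda>x. 0)"
      using smooth_on_tensor_deriv[of "{}" "\<lambda>_ _ _. 0" U "\<lambda>_. 0"] by (simp add: tensor_sum_def[abs_def])
  qed (rule compact_empty, simp_all)
  then have "\<psi> \<in> Cc_smooth_vec U"
    unfolding Cc_smooth_vec_def \<psi>_def axis_def vec_lambda_beta mem_Collect_eq
    using g(1) by (intro allI) (rename_tac j, case_tac "j = i"; simp)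
  then have "inner_on U f \<psi> = 0" by (rule assms(3))
  moreover have "inner_on U f \<psi> = (LINT x:U|lborel. f x $ i * g x)"
  proof -
    have "(LINT x:U|lborel. f x $ l * \<psi> x $ l) = (if l = i then LINT x:U|lborel. f x $ i * g x else 0)" for l
      by (auto simp: \<psi>_def axis_def set_lebesgue_integral_def)
    then show ?thesis by (simp add: inner_on_def)
  qed
  ultimately have "(LINT x:U|lborel. f x $ i * g x) = 0" by simp
  then have "0 = (LINT x:U|lborel. sgn (f x0 $ i) * (f x $ i * g x))" by simp
  also have "\<dots> = (LINT x:cbox a b|lborel. ?f x * g x)"
    unfolding set_lebesgue_integral_def using ab(1) g(4)
    by (intro Bochner_Integration.integral_cong refl) (auto simp: indicator_def mult.assoc)
  finally have int0: "(LINT x:cbox a b|lborel. ?f x * g x) = 0" by simp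
  have cg: "continuous_on (cbox a b) (\<lambda>x. ?f x * g x)"
    by (rule continuous_on_subset[OF continuous_on_mult[OF cf continuous_on_Cc_smooth[OF g(1)]]])
      (use ab(1) in auto)
  then have "set_integrable lborel (cbox a b) (\<lambda>x. ?f x * g x)"
    unfolding set_integrable_def by (intro borel_integrable_compact) auto
  from set_borel_integral_eq_integral[OF this]
  have "((\<lambda>x. ?f x * g x) has_integral 0) (cbox a b)"
    unfolding int0 by (simp add: has_integral_iff)
  moreover have "0 \<le> ?f x * g x" if "x \<in> cbox a b" for x
  proof -
    have "0 < ?f x" using ab(1) that by blast
    then show ?thesis by (rule mult_nonneg_nonneg[OF less_imp_le g(2)])
  qed
  ultimately have "?f x0 * g x0 = 0"
    using ab(2) subsetD[OF box_subset_cbox[of a b]]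
    by (intro has_integral_0_cbox_imp_0[OF cg]) auto
  then show False
    using i g(3) by (simp add: sgn_if split: if_splits)
qed

text \<open>
  The hypothesis compares kernels of the functionals \<open>inner_on U (f k)\<close> on the test functions, so
  \<open>inner_on U g\<close> is a linear combination of them. With the same coefficients, \<open>g\<close> minus the
  combination of the \<open>f k\<close> is orthogonal to all test functions, hence zero.
\<close>

lemma fun_in_span_if_orthogonality_inherited:
  fixes f :: "'k \<Rightarrow> real^'d::finite \<Rightarrow> real^'m::finite"
  assumes "open U" "finite K" "\<And>k. k \<in> K \<Longrightarrow> continuous_on U (f k)" "continuous_on U g"
    and "\<And>\<psi>. \<psi> \<in> Cc_smooth_vec U \<Longrightarrow> (\<forall>k\<in>K. inner_on U (f k) \<psi> = 0) \<Longrightarrow> inner_on U g \<psi> = 0"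
  shows "\<exists>c. \<forall>x\<in>U. g x = (\<Sum>k\<in>K. c k *\<^sub>R f k x)"
proof -
  have "\<exists>c. \<forall>\<psi>\<in>Cc_smooth_vec U. inner_on U g \<psi> = (\<Sum>k\<in>K. c k * inner_on U (f k) \<psi>)"
  proof (rule functional_in_span[where \<Lambda> = "\<lambda>k. inner_on U (f k)" and M = "inner_on U g"])
    fix \<phi> \<psi> :: "real^'d \<Rightarrow> real^'m" and a
    assume test: "\<phi> \<in> Cc_smooth_vec U" "\<psi> \<in> Cc_smooth_vec U"
    show "(\<lambda>x. \<phi> x + a *\<^sub>R \<psi> x) \<in> Cc_smooth_vec U"
      using assms(1) test by (rule Cc_smooth_vec_lincomb)
    show "inner_on U g (\<lambda>x. \<phi> x + a *\<^sub>R \<psi> x) = inner_on U g \<phi> + a * inner_on U g \<psi>"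
      using assms(1,4) test by (rule inner_on_lincomb_right)
    show "inner_on U (f k) (\<lambda>x. \<phi> x + a *\<^sub>R \<psi> x) = inner_on U (f k) \<phi> + a * inner_on U (f k) \<psi>"
      if "k \<in> K" for k
      using assms(1) assms(3)[OF that] test by (rule inner_on_lincomb_right)
  qed (use assms(2,5) in auto)
  then obtain c where c: "\<And>\<psi>. \<psi> \<in> Cc_smooth_vec U \<Longrightarrow>
      inner_on U g \<psi> = (\<Sum>k\<in>K. c k * inner_on U (f k) \<psi>)" by blast
  \<comment> \<open>The difference \<open>g - (\<Sum>k\<in>K. c k *\<^sub>R f k)\<close> as a single linear combination, with index \<open>None\<close>
     for \<open>g\<close>, so that \<open>inner_on_lincomb_left\<close> applies to it.\<close>
  define e where "e = case_option (1::real) (\<lambda>k. - c k)"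
  define F where "F = case_option g f"
  let ?K = "insert None (Some ` K)"
  have sum_K: "(\<Sum>k\<in>?K. G k) = G None + (\<Sum>k\<in>K. G (Some k))" for G :: "'k option \<Rightarrow> 'z::comm_monoid_add"
    using assms(2) by (simp add: sum.reindex)
  let ?r = "\<lambda>x. \<Sum>k\<in>?K. e k *\<^sub>R F k x"
  have cF: "continuous_on U (F k)" if "k \<in> ?K" for k
    using that assms(3,4) by (auto simp: F_def)
  have "?r x = 0" if "x \<in> U" for x
  proof (rule zero_if_orthogonal_to_Cc_smooth_vec[OF assms(1) _ _ that])
    show "continuous_on U ?r"
      using cF by (intro continuous_intros) auto
    fix \<psi> :: "real^'d \<Rightarrow> real^'m" assume \<psi>: "\<psi> \<in> Cc_smooth_vec U"
    have "inner_on U ?r \<psi> = (\<Sum>k\<in>?K. e k * inner_on U (F k) \<psi>)"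
      using assms(1,2) cF \<psi> by (intro inner_on_lincomb_left) auto
    then show "inner_on U ?r \<psi> = 0"
      unfolding sum_K by (simp add: e_def F_def c[OF \<psi>] sum_negf)
  qed
  then have "\<forall>x\<in>U. g x = (\<Sum>k\<in>K. c k *\<^sub>R f k x)"
    unfolding sum_K by (simp add: e_def F_def sum_negf)
  then show ?thesis by blast
qed

section \<open>From dependence on each test function to dependence of operators\<close>

text \<open>
  The coefficients in the hypothesis may vary with \<open>\<phi>\<close>. One \<open>\<phi>\<close> can be given independent unit
  jets at any finite set of points, so that finitely many coefficients of the operators, one at each
  point, satisfy linear relations with common constants.
  \<open>combination_from_finitely_many_points\<close> removes the restriction to finite sets of points.
\<close>

lemma pdo_in_span_if_pointwise_in_span:
  fixes U :: "(real^'d::{finite,linorder}) set"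
    and Ls :: "'k \<Rightarrow> ('d, 'n::finite, 'm::finite) pdo" and L :: "('d, 'n, 'm) pdo"
  assumes "open U" "finite K" "\<And>k. k \<in> K \<Longrightarrow> is_pdo U (Ls k)" "is_pdo U L"
    and span: "\<And>\<phi>. \<phi> \<in> Cc_smooth_vec U \<Longrightarrow>
      \<exists>c. \<forall>x\<in>U. pdo_apply U L \<phi> x = (\<Sum>k\<in>K. c k *\<^sub>R pdo_apply U (Ls k) \<phi> x)"
  shows "\<exists>c. \<forall>\<alpha>. \<forall>x\<in>U. L \<alpha> x = (\<Sum>k\<in>K. c k *\<^sub>R Ls k \<alpha> x)"
proof -
  define entry where "entry P x t = (case t of (\<alpha>, i, j) \<Rightarrow> P \<alpha> x $ i $ j)"
    for P :: "('d, 'n, 'm) pdo" and x and t :: "(nat^'d::{finite,linorder}) \<times> 'm \<times> 'n"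
  have cont: "continuous_on U (\<lambda>x. entry P x t)" if "is_pdo U P" for P t
  proof -
    have "continuous_on U (\<lambda>x. P \<alpha> x $ i $ j)" for \<alpha> i j
      using that by (intro continuous_on_component) (simp add: is_pdo_def)
    then show ?thesis by (cases t rule: prod_cases3) (simp add: entry_def)
  qed
  have "\<exists>c. \<forall>x\<in>U. \<forall>t. entry L x t = (\<Sum>k\<in>K. c k * entry (Ls k) x t)"
  proof (rule combination_from_finitely_many_points[where A = "\<lambda>k. entry (Ls k)" and B = "entry L",
        OF assms(2,1) cont[OF assms(3)] cont[OF assms(4)]])
    fix F :: "(real^'d::{finite,linorder}) set"
      and \<tau> :: "real^'d::{finite,linorder} \<Rightarrow> (nat^'d::{finite,linorder}) \<times> 'm \<times> 'n"
    assume F: "finite F" "F \<subseteq> U"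
    obtain \<phi> where \<phi>: "\<phi> \<in> Cc_smooth_vec U" and jet: "\<And>x \<beta> l. x \<in> F \<Longrightarrow>
        multi_deriv \<beta> (\<lambda>y. \<phi> y $ l) x = (if \<beta> = fst (\<tau> x) \<and> l = snd (snd (\<tau> x)) then 1 else 0)"
      by (rule Cc_smooth_vec_with_jets[OF assms(1) F,
            of "\<lambda>x. fst (\<tau> x)" "\<lambda>x. snd (snd (\<tau> x))"]) (rule that)
    obtain c where c: "\<And>x. x \<in> U \<Longrightarrow> pdo_apply U L \<phi> x = (\<Sum>k\<in>K. c k *\<^sub>R pdo_apply U (Ls k) \<phi> x)"
      using span[OF \<phi>] by blast
    have read_off: "pdo_apply U P \<phi> x $ fst (snd (\<tau> x)) = entry P x (\<tau> x)"
      if "is_pdo U P" "x \<in> F" for P x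
    proof -
      have "x \<in> U" using that(2) F(2) by blast
      then show ?thesis
        unfolding entry_def case_prod_beta by (rule pdo_apply_jet[OF that(1) _ jet[OF that(2)]])
    qed
    have "entry L x (\<tau> x) = (\<Sum>k\<in>K. c k * entry (Ls k) x (\<tau> x))" if x: "x \<in> F" for x
    proof -
      have "pdo_apply U L \<phi> x $ fst (snd (\<tau> x)) =
          (\<Sum>k\<in>K. c k * pdo_apply U (Ls k) \<phi> x $ fst (snd (\<tau> x)))"
        using c[of x] F(2) x by (simp add: sum_component subsetD)
      then show ?thesis
        using read_off[OF assms(4) x] read_off[OF assms(3) x] by simp
    qed
    then show "\<exists>c. \<forall>x\<in>F. entry L x (\<tau> x) = (\<Sum>k\<in>K. c k * entry (Ls k) x (\<tau> x))" by blast
  qed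
  then obtain c where c: "\<And>x t. x \<in> U \<Longrightarrow> entry L x t = (\<Sum>k\<in>K. c k * entry (Ls k) x t)"
    by blast
  have "L \<alpha> x $ i $ j = (\<Sum>k\<in>K. c k * Ls k \<alpha> x $ i $ j)" if "x \<in> U" for \<alpha> x i j
    using c[OF that, of "(\<alpha>, i, j)"] by (simp add: entry_def)
  then show ?thesis
    by (intro exI[of _ c]) (simp add: vec_eq_iff sum_component)
qed

section \<open>Equivalence of the three conditions\<close>

theorem theorem4:
  fixes U :: "(real^'d::{finite,linorder}) set"
    and r :: nat
    and Ls :: "nat \<Rightarrow> ('d, 'n::finite, 'm::finite) pdo"
    and L :: "('d, 'n, 'm) pdo"
  assumes "open U"
    and "\<And>k. k \<in> {1..r} \<Longrightarrow> is_pdo U (Ls k)"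
    and "is_pdo U L"
  shows "((\<forall>\<phi>\<in>Cc_smooth_vec U. \<forall>\<psi>\<in>Cc_smooth_vec U.
            (\<forall>k\<in>{1..r}. inner_on U (pdo_apply U (Ls k) \<phi>) \<psi> = 0)
              \<longrightarrow> inner_on U (pdo_apply U L \<phi>) \<psi> = 0)
          \<longleftrightarrow> pdo_in_Lin U r Ls L) \<and>
         ((\<forall>\<phi>\<in>Cc_smooth_vec U. fun_in_Lin U r (\<lambda>k. pdo_apply U (Ls k) \<phi>) (pdo_apply U L \<phi>))
          \<longleftrightarrow> pdo_in_Lin U r Ls L)"
    (is "(?orth \<longleftrightarrow> ?lin) \<and> (?loc \<longleftrightarrow> ?lin)")
proof -
  have fin: "finite {1..r}" by simp
  have cont: "continuous_on U (pdo_apply U (Ls k) \<phi>)" if "\<phi> \<in> Cc_smooth_vec U" "k \<in> {1..r}" for \<phi> k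
    using assms(2) that by (intro continuous_on_pdo_apply) auto
  have "?loc" if ?lin
  proof -
    obtain c where c: "\<And>\<alpha> x. x \<in> U \<Longrightarrow> L \<alpha> x = (\<Sum>k=1..r. c k *\<^sub>R Ls k \<alpha> x)"
      using \<open>?lin\<close> unfolding pdo_in_Lin_def by blast
    show ?thesis
      unfolding fun_in_Lin_def
      by (intro ballI exI[of _ c]) (rule pdo_apply_lincomb[OF fin assms(3,2) c])
  qed
  moreover have "?orth" if ?loc
  proof (intro ballI impI)
    fix \<phi> :: "real^'d::{finite,linorder} \<Rightarrow> real^'n::finite"
      and \<psi> :: "real^'d::{finite,linorder} \<Rightarrow> real^'m::finite"
    assume \<phi>: "\<phi> \<in> Cc_smooth_vec U" and \<psi>: "\<psi> \<in> Cc_smooth_vec U"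
      and orth: "\<forall>k\<in>{1..r}. inner_on U (pdo_apply U (Ls k) \<phi>) \<psi> = 0"
    obtain c where "\<And>x. x \<in> U \<Longrightarrow> pdo_apply U L \<phi> x = (\<Sum>k=1..r. c k *\<^sub>R pdo_apply U (Ls k) \<phi> x)"
      using \<open>?loc\<close> \<phi> unfolding fun_in_Lin_def by blast
    from inner_on_lincomb_left[OF assms(1) fin cont[OF \<phi>] \<psi> this] orth
    show "inner_on U (pdo_apply U L \<phi>) \<psi> = 0" by simp
  qed
  moreover have "?loc" if ?orth
    unfolding fun_in_Lin_def
  proof
    fix \<phi> :: "real^'d::{finite,linorder} \<Rightarrow> real^'n::finite"
    assume \<phi>: "\<phi> \<in> Cc_smooth_vec U"
    show "\<exists>c. \<forall>x\<in>U. pdo_apply U L \<phi> x = (\<Sum>k=1..r. c k *\<^sub>R pdo_apply U (Ls k) \<phi> x)"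
      by (rule fun_in_span_if_orthogonality_inherited[OF assms(1) fin cont[OF \<phi>]
            continuous_on_pdo_apply[OF assms(3) \<phi>]])
        (use \<open>?orth\<close> \<phi> in auto)
  qed
  moreover have "?lin" if ?loc
    unfolding pdo_in_Lin_def
    by (rule pdo_in_span_if_pointwise_in_span[OF assms(1) fin assms(2,3)])
      (use \<open>?loc\<close> in \<open>auto simp: fun_in_Lin_def\<close>)
  ultimately show ?thesis by blast
qed

end
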